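(* Let $R$ be a ring. Then $R$ is a $UJ^{\#}$ ring if and only if $R/J(R)$ is a $UU$ ring.
   Context: All rings are associative with identity. $J(R)$ is the Jacobson radical, $U(R)$ the group of units and $Nil(R)$ the set of nilpotent elements of $R$. Define $J^{\#}(R)=\{z\in R : z^n\in J(R)\text{ for some } n\ge 1\}$. A ring $R$ is called a $UJ^{\#}$ ring if $U(R)=1+J^{\#}(R)$, and a $UU$ ring if $U(R)=1+Nil(R)$. *)

theory Defs
  imports "HOL-Algebra.QuotRing"
begin

text \<open>
  Rings are associative with identity, not necessarily commutative; the zero ring is allowed.
  The ideals of HOL-Algebra are two-sided, so (maximal) left ideals are introduced here.
\<close>

locale left_ideal = additive_subgroup I R + ring R for I and R (structure) +
  assumes I_l_closed: "\<lbrakk>a \<in> I; x \<in> carrier R\<rbrakk> \<Longrightarrow> x \<otimes> a \<in> I"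

locale maximal_left_ideal = left_ideal +
  assumes I_notcarr: "carrier R \<noteq> I"
    and I_maximal: "\<lbrakk>left_ideal J R; I \<subseteq> J; J \<subseteq> carrier R\<rbrakk> \<Longrightarrow> J = I \<or> J = carrier R"

text \<open>
  The restriction to the carrier makes the intersection over the empty family (which
  occurs only for the zero ring) equal to the whole ring.
\<close>

definition jacobson_radical :: "('a, 'b) ring_scheme \<Rightarrow> 'a set" where
  "jacobson_radical R = {x \<in> carrier R. \<forall>M. maximal_left_ideal M R \<longrightarrow> x \<in> M}"

definition nilpotents :: "('a, 'b) ring_scheme \<Rightarrow> 'a set" where
  "nilpotents R = {z \<in> carrier R. \<exists>n::nat. n \<ge> 1 \<and> z [^]\<^bsub>R\<^esub> n = \<zero>\<^bsub>R\<^esub>}"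

definition J_sharp :: "('a, 'b) ring_scheme \<Rightarrow> 'a set" where
  "J_sharp R = {z \<in> carrier R. \<exists>n::nat. n \<ge> 1 \<and> z [^]\<^bsub>R\<^esub> n \<in> jacobson_radical R}"

locale UJ_sharp_ring = ring +
  assumes Units_eq: "Units R = \<one> <+ J_sharp R"

locale UU_ring = ring +
  assumes Units_eq: "Units R = \<one> <+ nilpotents R"

end

theory Submission
  imports Defs
begin

text \<open>
  An element \<open>x\<close> lies in \<open>J(R)\<close> iff every \<open>1 - rx\<close> has a left inverse. This makes \<open>J(R)\<close>
  a two-sided ideal with \<open>1 - J(R) \<subseteq> U(R)\<close>, so that \<open>a\<close> is a unit of \<open>R\<close> iff its class is a
  unit of \<open>R/J(R)\<close>. Since \<open>a - 1 \<in> J\<^sup>#(R)\<close> iff the class of \<open>a - 1\<close> is nilpotent, the two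
  conditions compare the same sets element by element.
\<close>

context ring
begin

section \<open>Left ideals and the existence of maximal ones\<close>

text \<open>Closure under negation comes from -x = (-1)x, a special case of closure under left
  multiplication.\<close>

lemma left_idealI:
  assumes "I \<subseteq> carrier R" "I \<noteq> {}"
    and add: "\<And>x y. \<lbrakk>x \<in> I; y \<in> I\<rbrakk> \<Longrightarrow> x \<oplus> y \<in> I"
    and lmult: "\<And>r x. \<lbrakk>r \<in> carrier R; x \<in> I\<rbrakk> \<Longrightarrow> r \<otimes> x \<in> I"
  shows "left_ideal I R"
proof -
  have "\<ominus> x \<in> I" if "x \<in> I" for x
  proof -
    have "\<ominus> x = (\<ominus> \<one>) \<otimes> x" using that assms(1) by (simp add: subset_iff l_minus)
    then show ?thesis using lmult that by simp
  qed
  then have "subgroup I (add_monoid R)"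
    using assms by (intro add.subgroupI) (auto simp: a_inv_def)
  then show ?thesis
    using lmult by (intro left_ideal.intro left_ideal_axioms.intro additive_subgroup.intro ring_axioms)
qed

lemma left_ideal_principal:
  assumes "x \<in> carrier R"
  shows "left_ideal ((\<lambda>r. r \<otimes> x) ` carrier R) R"
proof (rule left_idealI)
  fix y z assume "y \<in> (\<lambda>r. r \<otimes> x) ` carrier R" "z \<in> (\<lambda>r. r \<otimes> x) ` carrier R"
  then obtain r s where "r \<in> carrier R" "y = r \<otimes> x" "s \<in> carrier R" "z = s \<otimes> x" by auto
  with assms show "y \<oplus> z \<in> (\<lambda>r. r \<otimes> x) ` carrier R"
    by (intro image_eqI[of _ _ "r \<oplus> s"]) (auto simp: l_distr)
next
  fix t y assume "t \<in> carrier R" "y \<in> (\<lambda>r. r \<otimes> x) ` carrier R"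
  then obtain r where "r \<in> carrier R" "y = r \<otimes> x" by auto
  with assms \<open>t \<in> carrier R\<close> show "t \<otimes> y \<in> (\<lambda>r. r \<otimes> x) ` carrier R"
    by (intro image_eqI[of _ _ "t \<otimes> r"]) (auto simp: m_assoc)
qed (use assms in auto)

lemma left_ideal_sum:
  assumes "left_ideal I R" "left_ideal K R"
  shows "left_ideal (I <+>\<^bsub>R\<^esub> K) R"
proof -
  interpret I: left_ideal I R by fact
  interpret K: left_ideal K R by fact
  show ?thesis
  proof (rule left_idealI)
    show "I <+>\<^bsub>R\<^esub> K \<subseteq> carrier R" by (auto simp: set_add_def')
    show "I <+>\<^bsub>R\<^esub> K \<noteq> {}"
      using I.zero_closed K.zero_closed unfolding set_add_def' by blast
  next
    fix x y assume "x \<in> I <+>\<^bsub>R\<^esub> K" "y \<in> I <+>\<^bsub>R\<^esub> K"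
    then obtain a b c d where *: "a \<in> I" "b \<in> K" "x = a \<oplus> b" "c \<in> I" "d \<in> K" "y = c \<oplus> d"
      by (auto simp: set_add_def')
    then have "x \<oplus> y = (a \<oplus> c) \<oplus> (b \<oplus> d)" by (simp add: a_ac)
    moreover have "a \<oplus> c \<in> I" "b \<oplus> d \<in> K" using * by simp_all
    ultimately show "x \<oplus> y \<in> I <+>\<^bsub>R\<^esub> K" unfolding set_add_def' by blast
  next
    fix r x assume r: "r \<in> carrier R" and "x \<in> I <+>\<^bsub>R\<^esub> K"
    then obtain a b where *: "a \<in> I" "b \<in> K" "x = a \<oplus> b" by (auto simp: set_add_def')
    with r have "r \<otimes> x = r \<otimes> a \<oplus> r \<otimes> b" by (simp add: r_distr)
    moreover have "r \<otimes> a \<in> I" "r \<otimes> b \<in> K" using * r I.I_l_closed K.I_l_closed by simp_all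
    ultimately show "r \<otimes> x \<in> I <+>\<^bsub>R\<^esub> K" unfolding set_add_def' by blast
  qed
qed

lemma left_ideal_eq_carrier:
  assumes "left_ideal I R" "\<one> \<in> I"
  shows "I = carrier R"
proof -
  interpret I: left_ideal I R by fact
  have "x \<in> I" if "x \<in> carrier R" for x
    using I.I_l_closed[OF assms(2) that] that by simp
  then show ?thesis by auto
qed

text \<open>Zorn's lemma for the left ideals that contain \<open>I\<close> and omit 1. For a left
  ideal, omitting 1 is the same as being proper, and this form visibly survives unions of
  chains.\<close>

lemma maximal_left_ideal_exists:
  assumes "left_ideal I R" "\<one> \<notin> I"
  obtains M where "maximal_left_ideal M R" "I \<subseteq> M"
proof -
  define A where "A = {K. left_ideal K R \<and> \<one> \<notin> K \<and> I \<subseteq> K}"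
  have "\<Union>C \<in> A" if "C \<noteq> {}" and C: "subset.chain A C" for C
  proof -
    have ideals: "left_ideal K R \<and> \<one> \<notin> K \<and> I \<subseteq> K" if "K \<in> C" for K
      using that C by (auto simp: A_def subset.chain_def)
    have "left_ideal (\<Union>C) R"
    proof (rule left_idealI)
      show "\<Union>C \<subseteq> carrier R"
        using ideals by (meson Sup_least additive_subgroup.a_subset left_ideal.axioms(1))
      obtain K where "K \<in> C" using \<open>C \<noteq> {}\<close> by auto
      then show "\<Union>C \<noteq> {}"
        using ideals additive_subgroup.zero_closed left_ideal.axioms(1) by blast
    next
      fix x y assume "x \<in> \<Union>C" "y \<in> \<Union>C"
      then obtain K L where KL: "K \<in> C" "x \<in> K" "L \<in> C" "y \<in> L" by auto
      \<comment> \<open>Comparability in the chain puts both summands into one member, where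
        addition is available.\<close>
      have "K \<subseteq> L \<or> L \<subseteq> K" using C KL by (auto simp: subset_chain_def)
      then obtain N where "N \<in> C" "x \<in> N" "y \<in> N" using KL by auto
      then have "x \<oplus> y \<in> N"
        using ideals by (meson additive_subgroup.a_closed left_ideal.axioms(1))
      with \<open>N \<in> C\<close> show "x \<oplus> y \<in> \<Union>C" by blast
    next
      fix r x assume "r \<in> carrier R" "x \<in> \<Union>C"
      then show "r \<otimes> x \<in> \<Union>C" using ideals left_ideal.I_l_closed by (metis Union_iff)
    qed
    with ideals \<open>C \<noteq> {}\<close> show ?thesis by (auto simp: A_def)
  qed
  moreover have "A \<noteq> {}" using assms by (auto simp: A_def)
  ultimately obtain M where M: "M \<in> A" and max: "\<And>K. \<lbrakk>K \<in> A; M \<subseteq> K\<rbrakk> \<Longrightarrow> K = M"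
    using subset_Zorn_nonempty[of A] by metis
  have "maximal_left_ideal M R"
  proof (intro maximal_left_ideal.intro maximal_left_ideal_axioms.intro)
    show "left_ideal M R" using M by (simp add: A_def)
    show "carrier R \<noteq> M" using M by (auto simp: A_def)
    fix K assume K: "left_ideal K R" "M \<subseteq> K" "K \<subseteq> carrier R"
    \<comment> \<open>Either \<open>K\<close> omits 1, so it lies in \<open>A\<close> and maximality
      gives \<open>K = M\<close>, or it contains 1 and is the whole ring.\<close>
    then show "K = M \<or> K = carrier R"
      using M max[of K] left_ideal_eq_carrier[of K] by (auto simp: A_def)
  qed
  with M that show thesis by (auto simp: A_def)
qed

section \<open>The Jacobson radical as a two-sided ideal\<close>

text \<open>If 1 - rx has no left inverse, then R(1 - rx) lies in a maximal left ideal; this also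
  contains rx, hence 1. Conversely, if a maximal left ideal M misses x, then M + Rx = R, so some 1 -
  rx lies in M, and a left inverse of it forces 1 into M.\<close>

lemma jacobson_radical_iff:
  "x \<in> jacobson_radical R \<longleftrightarrow>
    x \<in> carrier R \<and> (\<forall>r \<in> carrier R. \<exists>s \<in> carrier R. s \<otimes> (\<one> \<ominus> r \<otimes> x) = \<one>)"
proof (intro iffI conjI ballI)
  assume x: "x \<in> jacobson_radical R"
  then show xc: "x \<in> carrier R" by (simp add: jacobson_radical_def)
  fix r assume r: "r \<in> carrier R"
  define y where "y = \<one> \<ominus> r \<otimes> x"
  have y: "y \<in> carrier R" using xc r by (simp add: y_def)
  let ?I = "(\<lambda>s. s \<otimes> y) ` carrier R"
  show "\<exists>s \<in> carrier R. s \<otimes> (\<one> \<ominus> r \<otimes> x) = \<one>"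
  proof (rule ccontr)
    assume "\<not> ?thesis"
    then have "\<one> \<notin> ?I" by (auto simp: y_def)
    then obtain M where M: "maximal_left_ideal M R" "?I \<subseteq> M"
      using maximal_left_ideal_exists[OF left_ideal_principal[OF y]] by blast
    interpret M: maximal_left_ideal M R by fact
    \<comment> \<open>The factor 1 is kept to show \<open>y\<close> as a member of the image
      \<open>?I\<close>.\<close>
    have "\<one> \<otimes> y \<in> M" using M(2) by blast
    moreover have "r \<otimes> x \<in> M" using x M r M.I_l_closed by (auto simp: jacobson_radical_def)
    ultimately have "\<one> \<otimes> y \<oplus> r \<otimes> x \<in> M" by (rule M.a_closed)
    moreover have "\<one> \<otimes> y \<oplus> r \<otimes> x = \<one>" using xc r unfolding y_def by algebra
    ultimately show False
      using left_ideal_eq_carrier[OF M.left_ideal_axioms] M.I_notcarr by auto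
  qed
next
  assume x: "x \<in> carrier R \<and> (\<forall>r \<in> carrier R. \<exists>s \<in> carrier R. s \<otimes> (\<one> \<ominus> r \<otimes> x) = \<one>)"
  have "x \<in> M" if "maximal_left_ideal M R" for M
  proof (rule ccontr)
    assume "x \<notin> M"
    interpret M: maximal_left_ideal M R by fact
    let ?P = "(\<lambda>r. r \<otimes> x) ` carrier R"
    have P: "left_ideal ?P R" using x left_ideal_principal by blast
    interpret S: left_ideal "M <+>\<^bsub>R\<^esub> ?P" R
      by (rule left_ideal_sum[OF M.left_ideal_axioms P])
    have "\<zero> \<in> ?P" using P additive_subgroup.zero_closed left_ideal.axioms(1) by blast
    have sum: "m \<oplus> p \<in> M <+>\<^bsub>R\<^esub> ?P" if "m \<in> M" "p \<in> ?P" for m p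
      using that unfolding set_add_def' by blast
    have "M \<subseteq> M <+>\<^bsub>R\<^esub> ?P"
    proof
      fix m assume "m \<in> M"
      with sum[OF this \<open>\<zero> \<in> ?P\<close>] show "m \<in> M <+>\<^bsub>R\<^esub> ?P" by simp
    qed
    moreover have "\<one> \<otimes> x \<in> ?P" by blast
    then have "x \<in> M <+>\<^bsub>R\<^esub> ?P" using sum[OF M.zero_closed] x by force
    ultimately have "M <+>\<^bsub>R\<^esub> ?P = carrier R"
      using M.I_maximal[OF S.left_ideal_axioms] \<open>x \<notin> M\<close> S.a_subset by auto
    then have "\<one> \<in> M <+>\<^bsub>R\<^esub> ?P" by (simp only: one_closed)
    then obtain m p where "m \<in> M" "p \<in> ?P" "\<one> = m \<oplus> p"
      unfolding set_add_def' by (elim UN_E singletonE)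
    then obtain r where mr: "m \<in> M" "r \<in> carrier R" "m \<oplus> r \<otimes> x = \<one>"
      by (elim imageE) simp
    then have "m \<in> carrier R" "r \<otimes> x \<in> carrier R" using x by auto
    \<comment> \<open>Solving for \<open>m\<close> identifies it as 1 - rx, to which the assumption
      on \<open>x\<close> applies.\<close>
    then have "(m \<oplus> r \<otimes> x) \<ominus> r \<otimes> x = m" by (simp add: minus_eq a_assoc r_neg)
    then have "\<one> \<ominus> r \<otimes> x = m" by (simp only: mr(3))
    then obtain s where "s \<in> carrier R" "s \<otimes> m = \<one>" using x mr(2) by auto
    then have "\<one> \<in> M" using M.I_l_closed[OF mr(1), of s] by simp
    then show False
      using left_ideal_eq_carrier[OF M.left_ideal_axioms] M.I_notcarr by auto
  qed
  with x show "x \<in> jacobson_radical R" by (simp add: jacobson_radical_def)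
qed

text \<open>The formula is suggested by the geometric series: the sum of the powers of ba is 1 +
  b(sum of the powers of ab)a, with \<open>s\<close> in place of the inner sum. It serves to move a
  right factor to the left in the criterion for the radical.\<close>

lemma left_inverse_swap:
  assumes "a \<in> carrier R" "b \<in> carrier R" "s \<in> carrier R" "s \<otimes> (\<one> \<ominus> a \<otimes> b) = \<one>"
  shows "(\<one> \<oplus> b \<otimes> s \<otimes> a) \<otimes> (\<one> \<ominus> b \<otimes> a) = \<one>"
proof -
  \<comment> \<open>The terms bsa - bsaba are regrouped as b(s(1 - ab))a, which equals ba and
    cancels.\<close>
  have "(\<one> \<oplus> b \<otimes> s \<otimes> a) \<otimes> (\<one> \<ominus> b \<otimes> a) = \<one> \<ominus> b \<otimes> a \<oplus> b \<otimes> (s \<otimes> (\<one> \<ominus> a \<otimes> b)) \<otimes> a"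
    using assms(1-3)
    by (simp add: minus_eq minus_add l_distr r_distr l_minus r_minus m_assoc a_ac)
  also have "\<dots> = \<one>" using assms by (simp add: minus_eq a_assoc l_neg)
  finally show ?thesis .
qed

text \<open>As an intersection of left ideals the radical is a left ideal. Closure under right
  multiplication is not visible from that definition; it follows from the left-inverse criterion and
  the swap of factors.\<close>

lemma jacobson_radical_ideal: "ideal (jacobson_radical R) R"
proof -
  let ?J = "jacobson_radical R"
  have J: "left_ideal ?J R"
  proof (rule left_idealI)
    have "\<zero> \<in> ?J" by (auto simp: jacobson_radical_iff minus_eq)
    then show "?J \<noteq> {}" by auto
  next
    fix x y assume "x \<in> ?J" "y \<in> ?J"
    then show "x \<oplus> y \<in> ?J"
      unfolding jacobson_radical_def
      by (auto intro!: additive_subgroup.a_closed left_ideal.axioms(1) maximal_left_ideal.axioms(1))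
  next
    fix r x assume "r \<in> carrier R" "x \<in> ?J"
    then show "r \<otimes> x \<in> ?J"
      unfolding jacobson_radical_def
      by (auto intro!: left_ideal.I_l_closed maximal_left_ideal.axioms(1))
  qed (auto simp: jacobson_radical_def)
  then interpret J: left_ideal ?J R .
  show ?thesis
  proof (rule idealI[OF ring_axioms J.a_subgroup J.I_l_closed])
    fix x a assume x: "x \<in> ?J" and a: "a \<in> carrier R"
    then have xc: "x \<in> carrier R" by simp
    show "x \<otimes> a \<in> ?J"
      unfolding jacobson_radical_iff
    proof (intro conjI ballI)
      fix r assume r: "r \<in> carrier R"
      \<comment> \<open>The criterion is used with multiplier ar, since 1 - (ar)x = 1 - a(rx) is the
        swapped form of the element 1 - (rx)a to be inverted.\<close>
      obtain s where s: "s \<in> carrier R" "s \<otimes> (\<one> \<ominus> (a \<otimes> r) \<otimes> x) = \<one>"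
        using x a r jacobson_radical_iff by (meson m_closed)
      then have "(\<one> \<oplus> (r \<otimes> x) \<otimes> s \<otimes> a) \<otimes> (\<one> \<ominus> (r \<otimes> x) \<otimes> a) = \<one>"
        using xc a r by (intro left_inverse_swap) (auto simp: m_assoc)
      then show "\<exists>t \<in> carrier R. t \<otimes> (\<one> \<ominus> r \<otimes> (x \<otimes> a)) = \<one>"
        using xc a r s by (intro bexI[of _ "\<one> \<oplus> (r \<otimes> x) \<otimes> s \<otimes> a"]) (auto simp: m_assoc)
    qed (use xc a in simp)
  qed
qed

section \<open>Units and nilpotents modulo an ideal\<close>

lemma left_right_inverse_Units:
  assumes "a \<in> carrier R" "b \<in> carrier R" "c \<in> carrier R" "b \<otimes> a = \<one>" "a \<otimes> c = \<one>"
  shows "a \<in> Units R"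
proof -
  have "b = c" using inv_unique[of b a c] assms by simp
  with assms show ?thesis by (auto simp: Units_def)
qed

text \<open>The criterion is applied twice: it gives a left inverse \<open>s\<close> of 1 - x, and
  since s = 1 + sx has the same shape, \<open>s\<close> has a left inverse too. Being invertible
  from both sides, \<open>s\<close> is a two-sided inverse of 1 - x.\<close>

lemma one_minus_jacobson_radical_Units:
  assumes x: "x \<in> jacobson_radical R"
  shows "\<one> \<ominus> x \<in> Units R"
proof -
  have xc: "x \<in> carrier R" using x by (simp add: jacobson_radical_def)
  obtain s where s: "s \<in> carrier R" "s \<otimes> (\<one> \<ominus> x) = \<one>"
    using x xc jacobson_radical_iff[of x] l_one[OF xc] by (metis one_closed)
  have "\<one> \<ominus> (\<ominus> s) \<otimes> x = s \<otimes> (\<one> \<ominus> x) \<oplus> s \<otimes> x"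
    using s xc by (simp add: minus_eq l_minus)
  also have "\<dots> = s" using s(1) xc by (simp add: minus_eq r_distr r_minus a_assoc l_neg)
  finally have "\<one> \<ominus> (\<ominus> s) \<otimes> x = s" .
  \<comment> \<open>Second use of the criterion, with multiplier -s.\<close>
  then obtain t where t: "t \<in> carrier R" "t \<otimes> s = \<one>"
    using x s jacobson_radical_iff[of x] by (metis a_inv_closed)
  have "t = \<one> \<ominus> x" using inv_unique[of t s "\<one> \<ominus> x"] t s xc by simp
  with s t xc show ?thesis by (auto simp: Units_def)
qed

lemma FactRing_carrier_iff: "X \<in> carrier (R Quot I) \<longleftrightarrow> (\<exists>a \<in> carrier R. X = I +> a)"
  by (auto simp: FactRing_def A_RCOSETS_def')

text \<open>Units lift modulo the radical: if b represents an inverse of the class of a, then ba and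
  ab are congruent to 1 and hence units of R, which gives a an inverse on each side. The converse
  only maps an inverse to the quotient.\<close>

lemma jacobson_radical_coset_Units_iff:
  assumes a: "a \<in> carrier R"
  shows "jacobson_radical R +> a \<in> Units (R Quot jacobson_radical R) \<longleftrightarrow> a \<in> Units R"
    (is "?J +> a \<in> Units ?Q \<longleftrightarrow> _")
proof -
  interpret J: ideal ?J R by (rule jacobson_radical_ideal)
  interpret Q: ring ?Q by (rule J.quotient_is_ring)
  \<comment> \<open>An element congruent to 1 is 1 - (1 - x) with 1 - x in the radical.\<close>
  have eqD: "x \<in> Units R" if "x \<in> carrier R" "?J +> x = ?J +> \<one>" for x
  proof -
    have "\<one> \<ominus> x \<in> ?J" using that quotient_eq_iff_same_a_r_cos[OF J.ideal_axioms] by simp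
    then have "\<one> \<ominus> (\<one> \<ominus> x) \<in> Units R" by (rule one_minus_jacobson_radical_Units)
    moreover have "\<one> \<ominus> (\<one> \<ominus> x) = x" using that(1) by algebra
    ultimately show ?thesis by simp
  qed
  show ?thesis
  proof
    assume "?J +> a \<in> Units ?Q"
    then obtain b where b: "b \<in> carrier R"
      "(?J +> b) \<otimes>\<^bsub>?Q\<^esub> (?J +> a) = \<one>\<^bsub>?Q\<^esub>" "(?J +> a) \<otimes>\<^bsub>?Q\<^esub> (?J +> b) = \<one>\<^bsub>?Q\<^esub>"
      by (auto simp: Units_def FactRing_carrier_iff)
    then have "?J +> b \<otimes> a = ?J +> \<one>" "?J +> a \<otimes> b = ?J +> \<one>"
      using a by (simp_all add: FactRing_def J.rcoset_mult_add)
    then have u: "b \<otimes> a \<in> Units R" "a \<otimes> b \<in> Units R" using eqD a b by auto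
    show "a \<in> Units R"
    proof (rule left_right_inverse_Units)
      show "inv (b \<otimes> a) \<otimes> b \<otimes> a = \<one>" using u a b by (simp add: m_assoc)
      show "a \<otimes> (b \<otimes> inv (a \<otimes> b)) = \<one>"
        using u a b by (simp add: m_assoc[symmetric] Units_r_inv)
    qed (use u a b in auto)
  next
    assume "a \<in> Units R"
    then obtain b where "b \<in> carrier R" "b \<otimes> a = \<one>" "a \<otimes> b = \<one>" by (auto simp: Units_def)
    with a have "(?J +> b) \<otimes>\<^bsub>?Q\<^esub> (?J +> a) = \<one>\<^bsub>?Q\<^esub>" "(?J +> a) \<otimes>\<^bsub>?Q\<^esub> (?J +> b) = \<one>\<^bsub>?Q\<^esub>"
      "?J +> a \<in> carrier ?Q" "?J +> b \<in> carrier ?Q"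
      using \<open>b \<in> carrier R\<close>
      by (auto simp: FactRing_def A_RCOSETS_def' J.rcoset_mult_add)
    then show "?J +> a \<in> Units ?Q"
      unfolding Units_def by blast
  qed
qed

text \<open>The projection commutes with powers, and a coset is zero exactly when its representative
  lies in the ideal. For the radical, the right-hand side is the condition defining
  \<open>J_sharp\<close>.\<close>

lemma coset_nilpotents_iff:
  assumes "ideal I R" "a \<in> carrier R"
  shows "I +> a \<in> nilpotents (R Quot I) \<longleftrightarrow> (\<exists>n::nat. n \<ge> 1 \<and> a [^] n \<in> I)"
proof -
  interpret I: ideal I R by fact
  interpret h: ring_hom_ring R "R Quot I" "(+>) I" by (rule I.rcos_ring_hom_ring)
  have "(I +> a) [^]\<^bsub>R Quot I\<^esub> n = \<zero>\<^bsub>R Quot I\<^esub> \<longleftrightarrow> a [^] n \<in> I" for n :: nat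
  proof -
    have "(I +> a) [^]\<^bsub>R Quot I\<^esub> n = I +> a [^] n"
      using assms(2) by (rule h.hom_nat_pow[symmetric])
    also have "\<dots> = \<zero>\<^bsub>R Quot I\<^esub> \<longleftrightarrow> a [^] n \<in> I"
      unfolding FactRing_def using assms(2) I.a_rcos_const[of "a [^] n"] I.a_rcos_self[of "a [^] n"]
      by auto
    finally show ?thesis .
  qed
  then show ?thesis using assms(2) by (auto simp: nilpotents_def)
qed

section \<open>Comparing the two conditions element by element\<close>

lemma a_l_coset_iff:
  assumes "S \<subseteq> carrier R" "u \<in> carrier R" "a \<in> carrier R"
  shows "a \<in> u <+ S \<longleftrightarrow> a \<ominus> u \<in> S"
proof
  assume "a \<in> u <+ S"
  then obtain z where "z \<in> S" "a = u \<oplus> z" by (auto simp: a_l_coset_def l_coset_def)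
  moreover from \<open>z \<in> S\<close> have "z \<in> carrier R" using assms(1) by blast
  then have "u \<oplus> z \<ominus> u = z" using assms(2) by algebra
  ultimately show "a \<ominus> u \<in> S" by simp
next
  assume "a \<ominus> u \<in> S"
  moreover have "a = u \<oplus> (a \<ominus> u)" using assms(2,3) by algebra
  ultimately show "a \<in> u <+ S" by (auto simp: a_l_coset_def l_coset_def)
qed

text \<open>Turns an equality of sets into a test on each a, which can be carried along the
  projection. It is used both in R and in the quotient.\<close>

lemma Units_eq_one_coset_iff:
  assumes "S \<subseteq> carrier R"
  shows "Units R = \<one> <+ S \<longleftrightarrow> (\<forall>a \<in> carrier R. a \<in> Units R \<longleftrightarrow> a \<ominus> \<one> \<in> S)"
proof -
  have "\<one> <+ S \<subseteq> carrier R" using assms by (auto simp: a_l_coset_def l_coset_def)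
  then have "Units R = \<one> <+ S \<longleftrightarrow> (\<forall>a \<in> carrier R. a \<in> Units R \<longleftrightarrow> a \<in> \<one> <+ S)"
    by blast
  also have "\<dots> \<longleftrightarrow> (\<forall>a \<in> carrier R. a \<in> Units R \<longleftrightarrow> a \<ominus> \<one> \<in> S)"
    using assms by (simp add: a_l_coset_iff)
  finally show ?thesis .
qed

end

theorem theorem2p22:
  fixes R (structure)
  assumes "ring R"
  shows "UJ_sharp_ring R \<longleftrightarrow> UU_ring (R Quot (jacobson_radical R))"
proof -
  interpret ring R by fact
  let ?J = "jacobson_radical R" and ?Q = "R Quot jacobson_radical R"
  interpret J: ideal ?J R by (rule jacobson_radical_ideal)
  interpret h: ring_hom_ring R ?Q "(+>) ?J" by (rule J.rcos_ring_hom_ring)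
  have diff: "(?J +> a) \<ominus>\<^bsub>?Q\<^esub> \<one>\<^bsub>?Q\<^esub> = ?J +> (a \<ominus> \<one>)" if "a \<in> carrier R" for a
    using that by (simp add: a_minus_def)
  have "UJ_sharp_ring R \<longleftrightarrow> Units R = \<one> <+ J_sharp R"
    using assms by (simp add: UJ_sharp_ring_def UJ_sharp_ring_axioms_def)
  also have "\<dots> \<longleftrightarrow> (\<forall>a \<in> carrier R. a \<in> Units R \<longleftrightarrow> a \<ominus> \<one> \<in> J_sharp R)"
    by (rule Units_eq_one_coset_iff) (auto simp: J_sharp_def)
  \<comment> \<open>For each \<open>a\<close>, both sides of the test pass to the quotient: units by
    lifting, membership in \<open>J_sharp R\<close> as nilpotency of the class of a - 1.\<close>
  also have "\<dots> \<longleftrightarrow> (\<forall>a \<in> carrier R. ?J +> a \<in> Units ?Q \<longleftrightarrow>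
      (?J +> a) \<ominus>\<^bsub>?Q\<^esub> \<one>\<^bsub>?Q\<^esub> \<in> nilpotents ?Q)"
    by (simp add: diff jacobson_radical_coset_Units_iff coset_nilpotents_iff[OF J.ideal_axioms]
        J_sharp_def)
  \<comment> \<open>Every element of the quotient is the class of some \<open>a\<close>, so
    representatives can be replaced by classes.\<close>
  also have "\<dots> \<longleftrightarrow> (\<forall>X \<in> carrier ?Q. X \<in> Units ?Q \<longleftrightarrow> X \<ominus>\<^bsub>?Q\<^esub> \<one>\<^bsub>?Q\<^esub> \<in> nilpotents ?Q)"
    unfolding Ball_def FactRing_carrier_iff by blast
  also have "\<dots> \<longleftrightarrow> Units ?Q = \<one>\<^bsub>?Q\<^esub> <+\<^bsub>?Q\<^esub> nilpotents ?Q"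
    by (rule h.S.Units_eq_one_coset_iff[symmetric]) (auto simp: nilpotents_def)
  also have "\<dots> \<longleftrightarrow> UU_ring ?Q"
    using h.S.ring_axioms by (simp add: UU_ring_def UU_ring_axioms_def)
  finally show ?thesis .
qed

end
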